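(* Let $q=p^s$ with $p>3$ prime and $s$ a positive integer, and let $\alpha\in\mathbb{F}_q$ with $\alpha\neq \pm 2$. Then the polynomial $$x^3+3\alpha x^2+(3\alpha^2-3)x+(\alpha^3-4\alpha)$$ is dynamically irreducible over $\mathbb{F}_q$ if and only if $-3(\alpha^2-4)$ is a nonzero square in $\mathbb{F}_{q}$ and the roots $\frac{1}{2}(\alpha\pm\sqrt{\alpha^2-4})$ of $x^2-\alpha x+1$ are not cubes in $\mathbb{F}_q(\sqrt{-3})$.
   Context: $\mathbb{F}_q$ is the finite field with $q$ elements. A polynomial $f\in K[x]$ of degree at least $2$ over a field $K$ is dynamically irreducible over $K$ if the $n$-fold composition $f^n=f\circ\cdots\circ f$ is irreducible over $K$ for all positive integers $n$. *)

theory Defs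
  imports "HOL-Library.Cardinality" "HOL-Algebra.Algebraic_Closure_Type" "HOL-Algebra.Generated_Fields"
begin

text \<open>
  The names \<open>irreducible\<close> and \<open>degree\<close> are also used by \<open>HOL-Algebra\<close>, hence the qualified
  names. A polynomial over a field is irreducible over that field iff it is an irreducible
  element of the ring \<open>'a poly\<close>.
\<close>

definition dynamically_irreducible :: "'a::field poly \<Rightarrow> bool" where
  "dynamically_irreducible f \<longleftrightarrow>
     Polynomial.degree f \<ge> 2 \<and>
     (\<forall>n::nat. n \<ge> 1 \<longrightarrow> Factorial_Ring.irreducible ((pcompose f ^^ n) [:0, 1:]))"

text \<open>
  The simple extension \<open>K(w)\<close> of the field \<open>K\<close> given by the type \<open>'a\<close>, realised inside the
  algebraic closure of \<open>K\<close>.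
\<close>

definition adjoin :: "'a::field alg_closure \<Rightarrow> 'a alg_closure set" where
  "adjoin w = generate_field ring_of_type_algebra (insert w (range to_ac))"

definition is_cube_in :: "'a::monoid_mult set \<Rightarrow> 'a \<Rightarrow> bool" where
  "is_cube_in L z \<longleftrightarrow> (\<exists>y\<in>L. z = y ^ 3)"

end

theory Submission
  imports Defs "HOL-Number_Theory.Residues"
begin

text \<open>
  With \<open>D y = y ^ 3 - 3 * y\<close> the cubic is \<open>D (x + \<alpha>) - \<alpha>\<close>, so it is conjugate to the Chebyshev map
  \<open>D\<close>, and \<open>D (g + 1 / g) = g ^ 3 + 1 / g ^ 3\<close>. Hence the roots of the \<open>n\<close>-th iterate are the
  \<open>g + 1 / g - \<alpha>\<close> for which \<open>g ^ 3 ^ n\<close> is a root of \<open>x\<^sup>2 - \<alpha> x + 1\<close>. If these two roots lie in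
  \<open>K = F\<^sub>q(\<surd>-3)\<close> and are not cubes there, then the Frobenius orbit of every root of the iterate has
  at least \<open>3 ^ n\<close> elements, because \<open>K\<close> contains the cube roots of unity (lifting the exponent at
  \<open>3\<close>); so the iterate is irreducible. Conversely, irreducibility of the cubic alone suffices: then
  Frobenius permutes its roots cyclically and fixes the square root of the discriminant, which is
  \<open>9\<close> times \<open>-3 (\<alpha>\<^sup>2 - 4)\<close>, and a cube root of \<open>(\<alpha> \<plusminus> \<delta>) / 2\<close> in \<open>K\<close> would give a root of the
  cubic in the quadratic extension.
\<close>

section \<open>Evaluating polynomials in the algebraic closure\<close>

definition poly_ac :: "'a::field poly \<Rightarrow> 'a alg_closure \<Rightarrow> 'a alg_closure" where
  "poly_ac P x = poly (map_poly to_ac P) x"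

lemma poly_ac_0 [simp]: "poly_ac 0 x = 0"
  by (simp add: poly_ac_def)

lemma poly_ac_pCons [simp]: "poly_ac (pCons a P) x = to_ac a + x * poly_ac P x"
  by (simp add: poly_ac_def map_poly_pCons)

lemma poly_ac_add [simp]: "poly_ac (P + Q) x = poly_ac P x + poly_ac Q x"
  by (induction P Q rule: poly_induct2) (auto simp: algebra_simps)

lemma poly_ac_smult [simp]: "poly_ac (Polynomial.smult a P) x = to_ac a * poly_ac P x"
  by (induction P) (auto simp: algebra_simps)

lemma poly_ac_mult [simp]: "poly_ac (P * Q) x = poly_ac P x * poly_ac Q x"
  by (induction P) (auto simp: algebra_simps)

lemma poly_ac_pcompose [simp]: "poly_ac (pcompose P Q) x = poly_ac P (poly_ac Q x)"
  by (induction P) (auto simp: pcompose_pCons)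

lemma degree_map_to_ac [simp]: "Polynomial.degree (map_poly to_ac P) = Polynomial.degree P"
  by (rule degree_map_poly) auto

lemma poly_ac_root_exists:
  assumes "Polynomial.degree P > 0"
  obtains x where "poly_ac P x = 0"
  using alg_closed_imp_poly_has_root[of "map_poly to_ac P"] assms by (auto simp: poly_ac_def)

lemma card_poly_ac_roots_le:
  assumes "P \<noteq> 0" "A \<subseteq> {x. poly_ac P x = 0}"
  shows "card A \<le> Polynomial.degree P"
proof -
  have nz: "map_poly to_ac P \<noteq> 0"
    using assms(1) by (simp add: map_poly_eq_0_iff)
  have "card A \<le> card {x. poly (map_poly to_ac P) x = 0}"
    using assms(2) poly_roots_finite[OF nz] by (intro card_mono) (auto simp: poly_ac_def)
  also have "\<dots> \<le> Polynomial.degree P"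
    using card_poly_roots_bound[OF nz] by simp
  finally show ?thesis .
qed

lemma degree_pcompose_funpow:
  fixes P :: "'a::field poly"
  shows "Polynomial.degree ((pcompose P ^^ n) [:0, 1:]) = Polynomial.degree P ^ n"
  by (induction n) (auto simp: degree_pcompose)

lemma irreducible_no_root:
  fixes P :: "'a::field poly"
  assumes "Factorial_Ring.irreducible P" "Polynomial.degree P \<ge> 2"
  shows "poly P a \<noteq> 0"
proof
  assume "poly P a = 0"
  then obtain R where R: "P = [:-a, 1:] * R"
    by (metis poly_eq_0_iff_dvd dvdE)
  have "\<not> [:-a, 1:] dvd 1"
    by (simp add: is_unit_iff_degree)
  then have "R dvd 1"
    using assms(1) R by (metis irreducibleD)
  then have "R \<noteq> 0" "Polynomial.degree R = 0"
    using is_unit_iff_degree[of R] by (metis not_is_unit_0, metis not_is_unit_0)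
  then have "Polynomial.degree ([:-a, 1:] * R) = 1"
    by (subst degree_mult_eq) auto
  then show False
    using assms(2) R by simp
qed


section \<open>The simple extension by a square root\<close>

lemma ring_of_type_algebra_simps [simp]:
  "carrier (ring_of_type_algebra :: 'a::field ring) = UNIV"
  "x \<oplus>\<^bsub>ring_of_type_algebra :: 'a::field ring\<^esub> y = x + y"
  "x \<otimes>\<^bsub>ring_of_type_algebra :: 'a::field ring\<^esub> y = x * y"
  "\<one>\<^bsub>ring_of_type_algebra :: 'a::field ring\<^esub> = 1"
  "\<zero>\<^bsub>ring_of_type_algebra :: 'a::field ring\<^esub> = 0"
  by (simp_all add: ring_of_type_algebra_def)

lemma ring_of_type_algebra_a_inv [simp]:
  "\<ominus>\<^bsub>ring_of_type_algebra :: 'a::field ring\<^esub> x = - x"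
proof -
  interpret ring "ring_of_type_algebra :: 'a ring" by rule
  show ?thesis
    by (rule minus_equality) auto
qed

lemma ring_of_type_algebra_m_inv [simp]:
  assumes "x \<noteq> 0"
  shows "inv\<^bsub>ring_of_type_algebra :: 'a::field ring\<^esub> x = inverse x"
proof -
  interpret cring "ring_of_type_algebra :: 'a ring" by rule
  show ?thesis
    by (rule comm_inv_char) (use assms in auto)
qed

text \<open>Minimality of the generated field. Closure under \<open>inverse\<close> may be asked of
  every element because \<open>inverse 0 = 0\<close>.\<close>

lemma adjoin_subset:
  assumes "w \<in> L" "range to_ac \<subseteq> L"
    and "\<And>x. x \<in> L \<Longrightarrow> - x \<in> L" "\<And>x. x \<in> L \<Longrightarrow> inverse x \<in> L"
    and "\<And>x y. x \<in> L \<Longrightarrow> y \<in> L \<Longrightarrow> x + y \<in> L" "\<And>x y. x \<in> L \<Longrightarrow> y \<in> L \<Longrightarrow> x * y \<in> L"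
  shows "adjoin w \<subseteq> L"
proof
  fix y assume "y \<in> adjoin w"
  then have "y \<in> generate_field ring_of_type_algebra (insert w (range to_ac))"
    by (simp add: adjoin_def)
  then show "y \<in> L"
  proof induction
    case one
    then show ?case using assms(2) to_ac_1 by (metis range_subsetD ring_of_type_algebra_simps(4))
  qed (use assms in auto)
qed

lemma to_ac_add_mult_in_adjoin: "to_ac a + to_ac b * w \<in> adjoin w"
proof -
  let ?R = "ring_of_type_algebra :: 'a alg_closure ring" and ?H = "insert w (range to_ac)"
  have "to_ac a \<oplus>\<^bsub>?R\<^esub> to_ac b \<otimes>\<^bsub>?R\<^esub> w \<in> generate_field ?R ?H"
    by (intro generate_field.eng_add generate_field.eng_mult generate_field.incl) auto
  then show ?thesis
    by (simp add: adjoin_def)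
qed


section \<open>Roots of unity of order a power of three\<close>

lemma power_gcd_eq_1:
  fixes x :: "'a::field"
  assumes "x ^ a = 1" "x ^ b = 1" "a \<noteq> 0"
  shows "x ^ gcd a b = 1"
proof -
  obtain u v where "a * u = b * v + gcd a b"
    using bezout_nat[OF assms(3)] by blast
  then have "(x ^ a) ^ u = (x ^ b) ^ v * x ^ gcd a b"
    by (metis power_mult power_add)
  then show ?thesis
    using assms by simp
qed

text \<open>The first two hypotheses say that \<open>x\<close> has order exactly
  \<open>3 ^ Suc n\<close>: the gcd of that order with \<open>m\<close> is a power of three, and a
  smaller one would already kill \<open>x ^ (3 ^ n)\<close>.\<close>

lemma order_power_three_dvd:
  fixes x :: "'a::field"
  assumes "x ^ (3 ^ Suc n) = 1" "x ^ (3 ^ n) \<noteq> 1" "x ^ m = 1"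
  shows "3 ^ Suc n dvd m"
proof -
  have g: "x ^ gcd (3 ^ Suc n) m = 1"
    using power_gcd_eq_1[OF assms(1,3)] by simp
  have "gcd (3 ^ Suc n) m dvd (3::nat) ^ Suc n" by simp
  moreover have "Factorial_Ring.prime (3::nat)" by simp
  ultimately obtain i where i: "i \<le> Suc n" "gcd (3 ^ Suc n) m = (3::nat) ^ i"
    using divides_primepow_nat by blast
  show ?thesis
  proof (cases "i = Suc n")
    case True
    then show ?thesis using i(2) by (metis gcd_dvd2)
  next
    case False
    then have "(3::nat) ^ n = 3 ^ i * 3 ^ (n - i)"
      using i(1) by (simp flip: power_add)
    then have "x ^ (3 ^ n) = 1"
      using g i(2) by (simp add: power_mult)
    then show ?thesis using assms(2) by simp
  qed
qed

text \<open>Lifting the exponent: modulo 3 the sum is \<open>k\<close>, so \<open>k = 3 * j\<close>,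
  and the sum for \<open>k\<close> is the sum for \<open>j\<close> times
  \<open>t\<^sup>2 + t + 1\<close> with \<open>t = r ^ j\<close>. As \<open>t\<close> is 1 modulo 3,
  that factor contains 3 exactly once, and induction on \<open>n\<close> applies to
  \<open>j\<close>.\<close>

lemma three_power_dvd_geometric_sum:
  fixes r :: int
  assumes "r mod 3 = 1" "r \<noteq> 1" "3 ^ n dvd (\<Sum>i<k. r ^ i)"
  shows "3 ^ n dvd int k"
  using assms(3)
proof (induction n arbitrary: k)
  case 0
  then show ?case by simp
next
  case (Suc n)
  have "[(\<Sum>i<k. r ^ i) = (\<Sum>i<k. 1 ^ i)] (mod 3)"
    using assms(1) by (intro cong_sum cong_pow) (simp add: cong_def)
  moreover have "3 dvd (\<Sum>i<k. r ^ i)"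
    using Suc.prems by (metis dvd_mult_left power_Suc)
  ultimately have "3 dvd int k"
    by (simp add: cong_dvd_iff)
  then have "3 dvd k"
    by presburger
  then obtain j where j: "k = 3 * j"
    by (auto elim: dvdE)
  define t where "t = r ^ j"
  have "[t = 1 ^ j] (mod 3)"
    unfolding t_def using assms(1) by (intro cong_pow) (simp add: cong_def)
  then have "t mod 3 = 1"
    by (simp add: cong_def)
  define u where "u = t div 3"
  have tu: "t = 3 * u + 1"
    using \<open>t mod 3 = 1\<close> unfolding u_def by presburger
  \<comment> \<open>The factorization is shown after multiplying by \<open>r - 1\<close>, which is
    cancelled at the end.\<close>
  have "(r - 1) * (\<Sum>i<k. r ^ i) = t ^ 3 - 1"
    by (simp add: power_diff_1_eq t_def j mult.commute flip: power_mult)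
  also have "\<dots> = (t - 1) * (t\<^sup>2 + t + 1)"
    by (simp add: algebra_simps power2_eq_square power3_eq_cube)
  also have "t - 1 = (r - 1) * (\<Sum>i<j. r ^ i)"
    by (simp add: power_diff_1_eq t_def)
  finally have "(\<Sum>i<k. r ^ i) = (\<Sum>i<j. r ^ i) * (t\<^sup>2 + t + 1)"
    using assms(2) by simp
  also have "t\<^sup>2 + t + 1 = 3 * (3 * (u\<^sup>2 + u) + 1)"
    by (simp add: tu algebra_simps power2_eq_square)
  finally have "(\<Sum>i<k. r ^ i) = 3 * ((\<Sum>i<j. r ^ i) * (3 * (u\<^sup>2 + u) + 1))"
    by (simp only: mult.left_commute)
  then have "3 * 3 ^ n dvd 3 * ((\<Sum>i<j. r ^ i) * (3 * (u\<^sup>2 + u) + 1))"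
    using Suc.prems by (simp only: power_Suc)
  then have "3 ^ n dvd (\<Sum>i<j. r ^ i) * (3 * (u\<^sup>2 + u) + 1)"
    by (simp only: dvd_mult_cancel_left) simp
  moreover have "coprime (3 ^ n) (3 * (u\<^sup>2 + u) + 1)"
    by (metis coprime_1_right coprime_power_left_iff coprime_iff_gcd_eq_1 gcd_add_mult mult.commute
        add.commute gcd.commute)
  ultimately have "3 ^ n dvd (\<Sum>i<j. r ^ i)"
    by (simp add: coprime_dvd_mult_left_iff)
  then have "3 ^ n dvd int j"
    by (rule Suc.IH)
  then show ?case
    by (simp add: j)
qed

text \<open>With \<open>r = 3 * m + 1\<close>, the element \<open>e = g ^ (r - 1)\<close> has order
  exactly \<open>3 ^ n\<close>. Since \<open>r ^ k - 1\<close> is \<open>r - 1\<close> times a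
  geometric sum, \<open>g ^ (r ^ k) = g\<close> forces \<open>3 ^ n\<close> to divide that sum,
  hence \<open>k\<close>. In the application \<open>r\<close> is the size of the extension field and
  \<open>c ^ m \<noteq> 1\<close> expresses that \<open>c\<close> is not a cube there.\<close>

lemma fixed_power_three_root:
  fixes g :: "'a::field"
  assumes "g \<noteq> 0" "g ^ (3 ^ n) = c" "c ^ (3 * m) = 1" "c ^ m \<noteq> 1"
    and "g ^ ((3 * m + 1) ^ k) = g"
  shows "3 ^ n dvd k"
proof (cases n)
  case (Suc l)
  define r where "r = 3 * m + 1"
  define S where "S = (\<Sum>i<k. r ^ i)"
  define e where "e = g ^ (3 * m)"
  have "m > 0"
    using assms(4) by (cases m) auto
  have "int r ^ k - 1 = int (3 * m) * int S"
    by (simp add: power_diff_1_eq S_def r_def)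
  then have "int (r ^ k) = int (3 * m * S + 1)"
    by simp
  then have "r ^ k = 3 * m * S + 1"
    by (simp only: of_nat_eq_iff)
  then have "g ^ (3 * m * S) * g = g"
    using assms(5) by (simp add: r_def mult.commute)
  then have "e ^ S = 1"
    using assms(1) by (simp add: e_def power_mult)
  moreover have "e ^ (3 ^ Suc l) = 1"
    using assms(2,3) Suc by (metis e_def power_mult mult.commute)
  moreover have "e ^ (3 ^ l) = c ^ m"
    unfolding e_def assms(2)[symmetric] Suc by (simp add: mult_ac flip: power_mult)
  ultimately have "3 ^ n dvd S"
    using order_power_three_dvd assms(4) Suc by metis
  then have "3 ^ n dvd int S"
    by (metis of_nat_dvd_iff of_nat_numeral of_nat_power)
  then have "3 ^ n dvd (\<Sum>i<k. int r ^ i)"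
    by (simp add: S_def)
  moreover have "int r mod 3 = 1" "int r \<noteq> 1"
    using \<open>m > 0\<close> by (simp_all add: r_def)
  ultimately have "3 ^ n dvd int k"
    by (intro three_power_dvd_geometric_sum[of "int r"])
  then show ?thesis
    by (metis of_nat_dvd_iff of_nat_numeral of_nat_power)
qed simp


section \<open>The Frobenius map of the algebraic closure\<close>

lemma finite_field_power_card:
  fixes x :: "'a::{field, finite}"
  shows "x ^ CARD('a) = x"
proof (cases "x = 0")
  case False
  \<comment> \<open>Multiplication by \<open>x\<close> permutes the nonzero elements; the extra
    factor \<open>x\<close> raises the exponent from \<open>CARD('a) - 1\<close> to
    \<open>CARD('a)\<close>.\<close>
  have "x * (\<Prod>y\<in>UNIV-{0}. x * y) = x * x ^ (CARD('a) - 1) * \<Prod>(UNIV-{0})"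
    by (simp add: prod.distrib mult_ac)
  also have "x * x ^ (CARD('a) - 1) = x ^ Suc (CARD('a) - 1)"
    by (subst power_Suc) auto
  also have "(\<Prod>y\<in>UNIV-{0}. x * y) = (\<Prod>y\<in>UNIV-{0}. y)"
    by (rule prod.reindex_bij_witness[of _ "\<lambda>y. y / x" "\<lambda>y. x * y"]) (use False in auto)
  also have "Suc (CARD('a) - 1) = CARD('a)"
    using finite_UNIV_card_ge_0[where ?'a = 'a] by simp
  finally show ?thesis
    by simp
qed (use finite_UNIV_card_ge_0[where ?'a = 'a] in auto)

locale finite_field_closure =
  fixes field_type :: "'q::{field, finite} itself" and p s q :: nat
  assumes prime_p: "Factorial_Ring.prime p" and p_gt_3: "p > 3"
    and q_eq: "q = p ^ s" and card_field: "CARD('q) = q"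
begin

lemma q_pos [simp]: "q > 0"
  using card_field finite_UNIV_card_ge_0[where ?'a = 'q] by simp

lemma CHAR_field: "CHAR('q) = p"
proof -
  have "Factorial_Ring.prime CHAR('q)"
    using finite_imp_CHAR_pos[where ?'a = 'q] prime_CHAR_semidom[where ?'a = 'q] by simp
  moreover have "CHAR('q) dvd p ^ s"
    using CHAR_dvd_CARD[where ?'a = 'q] card_field q_eq by simp
  ultimately show ?thesis
    using prime_p by (metis prime_dvd_power primes_dvd_imp_eq)
qed

text \<open>This is where \<open>p > 3\<close> enters: 2 and 3 become invertible.\<close>

lemma small_nat_neq_0: "of_nat n \<noteq> (0 :: 'q alg_closure)" if "0 < n" "n \<le> 3"
proof
  assume "of_nat n = (0 :: 'q alg_closure)"
  then have "p dvd n"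
    using of_nat_eq_0_iff_char_dvd[of n, where ?'a = "'q alg_closure"] CHAR_field by simp
  then show False
    using that p_gt_3 nat_dvd_not_less by auto
qed

lemma two_neq_0 [simp]: "(2 :: 'q alg_closure) \<noteq> 0" and three_neq_0 [simp]: "(3 :: 'q alg_closure) \<noteq> 0"
  using small_nat_neq_0[of 2] small_nat_neq_0[of 3] by simp_all

lemma four_neq_0 [simp]: "(4 :: 'q alg_closure) \<noteq> 0"
  using mult_eq_0_iff[of "2 :: 'q alg_closure" 2] by simp

lemma frob_add: "(x + y :: 'q alg_closure) ^ (q ^ k) = x ^ (q ^ k) + y ^ (q ^ k)"
  by (rule freshmans_dream'[where n = "s * k"])
    (use prime_p in \<open>simp_all add: CHAR_field q_eq power_mult\<close>)

lemma frob_diff: "(x - y :: 'q alg_closure) ^ (q ^ k) = x ^ (q ^ k) - y ^ (q ^ k)"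
  using frob_add[of "x - y" y k] by (simp add: algebra_simps)

lemma frob_minus: "(- y :: 'q alg_closure) ^ (q ^ k) = - (y ^ (q ^ k))"
  using frob_diff[of 0 y k] by (simp add: power_0_left)

lemma frob_to_ac [simp]: "to_ac (a :: 'q) ^ (q ^ k) = to_ac a"
proof (induction k)
  case (Suc k)
  then show ?case
    by (simp add: power_mult mult.commute flip: to_ac_power)
      (metis finite_field_power_card card_field to_ac_power)
qed simp

lemma frob_numeral [simp]: "(numeral m :: 'q alg_closure) ^ (q ^ k) = numeral m"
  by (metis frob_to_ac to_ac_numeral)

lemma frob_frob: "((x :: 'q alg_closure) ^ (q ^ i)) ^ (q ^ j) = x ^ (q ^ (i + j))"
  by (simp add: power_add power_mult)

lemma frob_inj: "(x :: 'q alg_closure) ^ (q ^ k) = y ^ (q ^ k) \<Longrightarrow> x = y"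
  using frob_diff[of x y k] by simp

lemma frob_fixed_iterate:
  assumes "(x :: 'q alg_closure) ^ (q ^ k) = x"
  shows "x ^ (q ^ (k * j)) = x"
proof (induction j)
  case (Suc j)
  then show ?case
    using assms by (metis frob_frob mult_Suc_right)
qed simp

lemma frob_fixed_iff: "(x :: 'q alg_closure) ^ q = x \<longleftrightarrow> x \<in> range to_ac"
proof
  assume x: "x ^ q = x"
  show "x \<in> range to_ac"
  proof (rule ccontr)
    assume nin: "x \<notin> range to_ac"
    \<comment> \<open>The base field already supplies \<open>q\<close> roots of
      \<open>X ^ q - X\<close>, so a further fixed point would exceed the degree.\<close>
    define P :: "'q alg_closure poly" where "P = monom 1 q + [:0, -1:]"
    have "q \<ge> 2"
      using card_mono[of UNIV "{0, 1 :: 'q}"] card_field by simp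
    then have deg: "Polynomial.degree P = q"
      unfolding P_def by (subst degree_add_eq_left) (auto simp: degree_monom_eq)
    with \<open>q \<ge> 2\<close> have "P \<noteq> 0" by auto
    have roots: "insert x (range to_ac) \<subseteq> {y. poly P y = 0}"
      using x frob_to_ac[of _ 1] by (auto simp: P_def poly_monom)
    have "Suc q = card (insert x (range (to_ac :: 'q \<Rightarrow> _)))"
      using nin by (simp add: card_image inj_to_ac card_field)
    also have "\<dots> \<le> card {y. poly P y = 0}"
      by (rule card_mono[OF poly_roots_finite[OF \<open>P \<noteq> 0\<close>] roots])
    also have "\<dots> \<le> q"
      using card_poly_roots_bound[OF \<open>P \<noteq> 0\<close>] deg by simp
    finally show False by simp
  qed
qed (use frob_to_ac[of _ 1] in auto)

lemma poly_ac_frob: "poly_ac (P :: 'q poly) x ^ (q ^ k) = poly_ac P (x ^ (q ^ k))"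
  by (induction P) (auto simp: frob_add power_mult_distrib power_0_left)

text \<open>A nonconstant factor contains the whole Frobenius orbit of each of its roots. The
  hypothesis makes the first \<open>degree P\<close> conjugates distinct, so the factor has full
  degree and its cofactor is constant.\<close>

lemma irreducible_if_long_orbits:
  fixes P :: "'q poly"
  assumes "Polynomial.degree P > 0"
    and "\<And>y k. poly_ac P y = 0 \<Longrightarrow> y ^ (q ^ k) = y \<Longrightarrow> Polynomial.degree P dvd k"
  shows "Factorial_Ring.irreducible P"
proof (rule irreducibleI)
  show "P \<noteq> 0"
    using assms(1) by auto
  then show "\<not> P dvd 1"
    using assms(1) by (simp add: is_unit_iff_degree)
next
  fix A B assume AB: "P = A * B"
  with assms(1) have nz: "A \<noteq> 0" "B \<noteq> 0" by auto
  show "A dvd 1 \<or> B dvd 1"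
  proof (cases "Polynomial.degree A = 0")
    case True
    then show ?thesis using nz is_unit_iff_degree by blast
  next
    case False
    then obtain y where y: "poly_ac A y = 0"
      using poly_ac_root_exists by blast
    let ?N = "Polynomial.degree P"
    have "y ^ (q ^ i) \<noteq> y ^ (q ^ j)" if "i < j" "j < ?N" for i j
    proof
      assume "y ^ (q ^ i) = y ^ (q ^ j)"
      then have "y ^ (q ^ i) = (y ^ (q ^ (j - i))) ^ (q ^ i)"
        using that by (simp add: frob_frob)
      then have "y = y ^ (q ^ (j - i))"
        by (rule frob_inj)
      then have "?N dvd j - i"
        using assms(2)[of y "j - i"] y AB by simp
      then show False
        using that by (simp add: nat_dvd_not_less)
    qed
    then have "inj_on (\<lambda>i. y ^ (q ^ i)) {..<?N}"
      by (auto intro: linorder_inj_onI)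
    then have "?N = card ((\<lambda>i. y ^ (q ^ i)) ` {..<?N})"
      by (simp add: card_image)
    also have "\<dots> \<le> Polynomial.degree A"
      using nz y by (intro card_poly_ac_roots_le) (auto simp flip: poly_ac_frob simp: power_0_left)
    finally have "Polynomial.degree B = 0"
      using AB nz by (simp add: degree_mult_eq)
    then show ?thesis using nz is_unit_iff_degree by blast
  qed
qed


section \<open>The field obtained by adjoining a square root of \<open>-3\<close>\<close>

lemma frob_fixed_adjoin:
  assumes "(w :: 'q alg_closure) ^ (q ^ d) = w" "y \<in> adjoin w"
  shows "y ^ (q ^ d) = y"
proof -
  have "adjoin w \<subseteq> {y. y ^ (q ^ d) = y}"
    by (rule adjoin_subset)
      (use assms(1) in \<open>auto simp: frob_add frob_minus power_mult_distrib power_inverse\<close>)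
  then show ?thesis
    using assms(2) by blast
qed

text \<open>Here \<open>d\<close> is 1 or 2 according to whether -3 has a square root in the base
  field. Describing the extension by Frobenius fixed points turns membership into a power
  identity.\<close>

lemma adjoin_sqrt_minus_3:
  fixes w :: "'q alg_closure"
  assumes w: "w ^ 2 = -3"
  obtains d where "d = 1 \<or> d = 2" "adjoin w = {y. y ^ (q ^ d) = y}"
proof (cases "w ^ q = w")
  case True
  have "y \<in> adjoin w" if "y ^ q = y" for y
    using that to_ac_add_mult_in_adjoin[of _ 0 w] unfolding frob_fixed_iff by auto
  then have "adjoin w = {y. y ^ (q ^ 1) = y}"
    using frob_fixed_adjoin[of w 1] True by auto
  then show ?thesis using that by blast
next
  case False
  have w0: "w \<noteq> 0" using w three_neq_0[symmetric] by auto
  have "(w ^ q) ^ 2 = w ^ 2"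
    using w frob_minus[of 3 1] frob_numeral[of _ 1] by (simp add: mult.commute flip: power_mult)
      (metis mult.commute power_mult)
  then have wq: "w ^ q = - w"
    using False by (simp add: power2_eq_iff)
  then have w2: "w ^ (q ^ 2) = w"
    using frob_minus[of w 1] by (simp add: power2_eq_square power_mult)
  have "y \<in> adjoin w" if y: "y ^ (q ^ 2) = y" for y
  proof -
    \<comment> \<open>Frobenius swaps \<open>y\<close> and \<open>z\<close> and negates
      \<open>w\<close>, so both coordinates \<open>(y + z) / 2\<close> and
      \<open>(y - z) / (2 * w)\<close> of \<open>y\<close> in the basis \<open>1, w\<close> are
      fixed by it.\<close>
    define z where "z = y ^ q"
    have zq: "z ^ q = y"
      using y by (simp add: z_def power2_eq_square power_mult)
    have "((y + z) / 2) ^ q = (y + z) / 2"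
      using frob_add[of y z 1] frob_numeral[of _ 1] zq by (simp add: power_divide z_def add.commute)
    then obtain a where a: "(y + z) / 2 = to_ac a"
      unfolding frob_fixed_iff by blast
    have "((y - z) / (2 * w)) ^ q = (z - y) / (2 * (- w))"
      using frob_diff[of y z 1] frob_numeral[of _ 1] zq wq
      by (simp add: power_divide power_mult_distrib z_def)
    also have "\<dots> = (y - z) / (2 * w)"
      using w0 by (simp add: field_simps)
    finally obtain b where b: "(y - z) / (2 * w) = to_ac b"
      unfolding frob_fixed_iff by blast
    have "y = (y + z) / 2 + (y - z) / (2 * w) * w"
      using w0 by (simp add: field_simps)
    then show ?thesis
      using to_ac_add_mult_in_adjoin[of a b w] a b by simp
  qed
  then have "adjoin w = {y. y ^ (q ^ 2) = y}"
    using frob_fixed_adjoin[of w 2] w2 by auto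
  then show ?thesis using that by blast
qed

text \<open>The field fixed by the \<open>d\<close>-th power of Frobenius contains the primitive
  cube root of unity \<open>(w - 1) / 2\<close>; its being fixed forces \<open>q ^ d\<close> to be 1
  modulo 3.\<close>

lemma primitive_cube_root_fixed:
  fixes w :: "'q alg_closure"
  assumes w: "w ^ 2 = -3" and fixed: "w ^ (q ^ d) = w"
  obtains m where "q ^ d = 3 * m + 1"
proof -
  define z where "z = (w - 1) / 2"
  have "w = 2 * z + 1"
    by (simp add: z_def)
  then have "4 * (z ^ 2 + z + 1) = 0"
    using w by (simp add: algebra_simps power2_eq_square)
  then have zz: "z ^ 2 + z + 1 = 0"
    by (simp only: mult_eq_0_iff four_neq_0 simp_thms)
  have "z ^ 3 - 1 = (z - 1) * (z ^ 2 + z + 1)"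
    by (simp add: algebra_simps power2_eq_square power3_eq_cube)
  then have z3: "z ^ 3 = 1"
    using zz by simp
  have z1: "z \<noteq> 1" using zz by auto
  have z0: "z \<noteq> 0" using zz by auto
  have zq: "z ^ (q ^ d) = z"
    using fixed by (simp add: z_def power_divide frob_diff)
  have "N = 3 * (N div 3) \<or> N = 3 * (N div 3) + 1 \<or> N = 3 * (N div 3) + 2" for N :: nat
    by presburger
  then obtain m where "q ^ d = 3 * m \<or> q ^ d = 3 * m + 1 \<or> q ^ d = 3 * m + 2"
    by blast
  moreover have "q ^ d \<noteq> 3 * m"
    using zq z3 z1 by (auto simp: power_mult)
  moreover have "q ^ d \<noteq> 3 * m + 2"
  proof
    assume "q ^ d = 3 * m + 2"
    then have "z = (z ^ 3) ^ m * z ^ 2"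
      using zq by (simp only: power_add power_mult)
    then have "z ^ 2 = z"
      using z3 by simp
    then show False
      using z0 z1 by (simp add: power2_eq_square)
  qed
  ultimately show ?thesis using that by blast
qed


section \<open>The Chebyshev cubic\<close>

definition cheb :: "'q \<Rightarrow> 'q poly" where
  "cheb a = [: a ^ 3 - 4 * a, 3 * a ^ 2 - 3, 3 * a, 1 :]"

lemma degree_cheb: "Polynomial.degree (cheb a) = 3"
  by (simp add: cheb_def)

lemma poly_ac_cheb:
  "poly_ac (cheb a) y = (y + to_ac a) ^ 3 - 3 * (y + to_ac a) - to_ac a"
  by (simp add: cheb_def algebra_simps power2_eq_square power3_eq_cube)

lemma reciprocal_sum_cubed:
  fixes h :: "'a::field"
  assumes "h \<noteq> 0"
  shows "(h + 1 / h) ^ 3 - 3 * (h + 1 / h) = h ^ 3 + 1 / h ^ 3"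
proof -
  define i where "i = 1 / h"
  have "(h + i) ^ 3 - 3 * (h + i) = h ^ 3 + i ^ 3 + 3 * (h * i - 1) * (h + i)"
    by (simp add: algebra_simps power3_eq_cube)
  moreover have "h * i = 1"
    using assms by (simp add: i_def)
  ultimately show ?thesis
    by (simp add: i_def power_divide)
qed

lemma poly_ac_cheb_iterate:
  assumes "g \<noteq> 0" "y + to_ac a = g + 1 / g"
  shows "poly_ac ((pcompose (cheb a) ^^ n) [:0, 1:]) y + to_ac a = g ^ (3 ^ n) + 1 / g ^ (3 ^ n)"
proof (induction n)
  case (Suc n)
  define h where "h = g ^ (3 ^ n)"
  have h: "h \<noteq> 0" "g ^ (3 ^ Suc n) = h ^ 3"
    using assms(1) by (simp_all add: h_def mult.commute flip: power_mult)
  show ?case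
    using Suc h reciprocal_sum_cubed[OF h(1)] by (simp add: poly_ac_cheb h_def)
qed (use assms in simp)

lemma ac_reciprocal_sum:
  obtains g :: "'q alg_closure" where "g \<noteq> 0" "x = g + 1 / g"
proof -
  obtain g where g: "poly [:1, - x, 1:] g = 0"
    using alg_closed_imp_poly_has_root[of "[:1, - x, 1:]"] by auto
  then have "g \<noteq> 0" by auto
  moreover have "x = g + 1 / g"
    using g \<open>g \<noteq> 0\<close> by (simp add: field_simps)
  ultimately show ?thesis using that by blast
qed

text \<open>By the orbit criterion it is enough that any Frobenius power fixing a root
  \<open>y\<close> has exponent divisible by \<open>3 ^ n\<close>. The argument passes from
  \<open>y\<close> to \<open>g\<close> with \<open>y + \<alpha> = g + 1 / g\<close>, at the cost of
  a factor 2 in the exponent.\<close>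

lemma cheb_iterate_irreducible:
  fixes w :: "'q alg_closure"
  assumes w: "w ^ 2 = -3" and d: "d = 1 \<or> d = 2" "adjoin w = {y. y ^ (q ^ d) = y}"
    and nc: "\<And>c. c \<noteq> 0 \<Longrightarrow> c + 1 / c = to_ac a \<Longrightarrow> c \<in> adjoin w \<and> \<not> is_cube_in (adjoin w) c"
  shows "Factorial_Ring.irreducible ((pcompose (cheb a) ^^ n) [:0, 1:])" (is "Factorial_Ring.irreducible ?P")
proof -
  have degP: "Polynomial.degree ?P = 3 ^ n"
    by (simp add: degree_pcompose_funpow degree_cheb)
  have "w \<in> adjoin w"
    using to_ac_add_mult_in_adjoin[of 0 1 w] by simp
  then have "w ^ (q ^ d) = w"
    using d by simp
  then obtain m where m: "q ^ d = 3 * m + 1"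
    using primitive_cube_root_fixed[OF w] by blast
  have "3 ^ n dvd k" if y: "poly_ac ?P y = 0" "y ^ (q ^ k) = y" for y k
  proof (cases n)
    case (Suc l)
    obtain g where g: "g \<noteq> 0" "y + to_ac a = g + 1 / g"
      using ac_reciprocal_sum by blast
    define c where "c = g ^ (3 ^ n)"
    have c0: "c \<noteq> 0" using g(1) by (simp add: c_def)
    have "c + 1 / c = to_ac a"
      using poly_ac_cheb_iterate[OF g, of n] y(1) by (simp add: c_def)
    then have c: "c \<in> adjoin w" "\<not> is_cube_in (adjoin w) c"
      using nc c0 by auto
    have "c ^ (3 * m) * c = c"
      using c(1) d m by (simp add: mult.commute)
    then have c3m: "c ^ (3 * m) = 1"
      using c0 by simp
    \<comment> \<open>Otherwise the cube root \<open>g ^ (3 ^ l)\<close> of \<open>c\<close> would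
      be fixed by the \<open>d\<close>-th Frobenius power and so lie in the extension.\<close>
    have cm: "c ^ m \<noteq> 1"
    proof
      assume "c ^ m = 1"
      define h where "h = g ^ (3 ^ l)"
      have h: "h ^ 3 = c"
        by (simp add: h_def c_def Suc mult.commute flip: power_mult)
      then have "h ^ (3 * m + 1) = h"
        using \<open>c ^ m = 1\<close> by (simp add: power_mult)
      then have "h \<in> adjoin w"
        using d m by simp
      then show False
        using c(2) h unfolding is_cube_in_def by blast
    qed
    define e where "e = g ^ (q ^ k)"
    have e0: "e \<noteq> 0" using g(1) by (simp add: e_def)
    have "e + 1 / e = (g + 1 / g) ^ (q ^ k)"
      by (simp add: frob_add power_divide e_def)
    also have "\<dots> = g + 1 / g"
      using y(2) by (simp add: frob_add flip: g(2))
    finally have "e + 1 / e = g + 1 / g" .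
    \<comment> \<open>The sum \<open>g + 1 / g\<close> determines \<open>g\<close> up to inversion,
      so the conjugate \<open>e\<close> is \<open>g\<close> or \<open>1 / g\<close>; applying
      Frobenius \<open>k\<close> more times fixes \<open>g\<close> in both cases.\<close>
    moreover have "(e - g) * (e * g - 1) = e * g * ((e + 1 / e) - (g + 1 / g))"
      using g(1) e0 by (simp add: algebra_simps)
    ultimately have "(e - g) * (e * g - 1) = 0"
      by simp
    then have "e = g \<or> e * g = 1"
      by simp
    then have "e = g \<or> e = 1 / g"
      using g(1) by (simp add: eq_divide_eq)
    then have "g ^ (q ^ (2 * k)) = g"
    proof
      assume "e = g"
      then show ?thesis
        using frob_fixed_iterate[of g k 2] by (simp add: e_def mult.commute)
    next
      assume "e = 1 / g"
      then have "e ^ (q ^ k) = g"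
        using e0 by (simp add: e_def power_divide)
      then show ?thesis
        by (simp add: e_def frob_frob mult_2)
    qed
    \<comment> \<open>The further factor \<open>d\<close> makes the exponent a power of
      \<open>q ^ d = 3 * m + 1\<close>.\<close>
    then have "g ^ (q ^ (2 * k * d)) = g"
      by (rule frob_fixed_iterate)
    then have "g ^ ((3 * m + 1) ^ (2 * k)) = g"
      by (metis m power_mult mult.commute)
    then have "3 ^ n dvd 2 * k"
      by (rule fixed_power_three_root[OF g(1) c_def[symmetric] c3m cm])
    then show ?thesis
      by (simp add: coprime_dvd_mult_right_iff)
  qed simp
  then show ?thesis
    by (intro irreducible_if_long_orbits) (simp_all add: degP)
qed

section \<open>Consequences of the irreducibility of the cubic\<close>

lemma frob_cheb_root:
  fixes a :: 'q
  assumes "r ^ 3 - 3 * r = to_ac a"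
  shows "(r ^ q) ^ 3 - 3 * r ^ q = to_ac a"
proof -
  have "(r ^ 3 - 3 * r) ^ q = (r ^ q) ^ 3 - 3 * r ^ q"
    using frob_diff[of "r ^ 3" "3 * r" 1] frob_numeral[of _ 1]
    by (simp add: power_mult_distrib) (metis mult.commute power_mult)
  then show ?thesis
    using assms frob_to_ac[of a 1] by simp
qed

text \<open>
  If \<open>x\<close> and \<open>x ^ q\<close> are distinct conjugate roots, the third root of the shifted cubic is
  \<open>- x - x ^ q\<close>; it would be rational if \<open>x\<close> were quadratic over the base field.
\<close>
lemma irreducible_cheb_no_quadratic_root:
  assumes irr: "Factorial_Ring.irreducible (cheb a)"
    and x: "x ^ 3 - 3 * x = to_ac a"
  shows "x ^ (q ^ 2) \<noteq> x"
proof
  assume x2: "x ^ (q ^ 2) = x"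
  have norat: "r ^ q \<noteq> r" if r: "r ^ 3 - 3 * r = to_ac a" for r
  proof
    assume "r ^ q = r"
    then obtain t where t: "r = to_ac t"
      unfolding frob_fixed_iff by blast
    have "to_ac (t ^ 3 - 3 * t) = to_ac a"
      using r t by simp
    then have ta: "t ^ 3 - 3 * t = a"
      by (simp only: to_ac_eq_iff)
    have "poly (cheb a) (t - a) = t ^ 3 - 3 * t - a"
      by (simp add: cheb_def algebra_simps power2_eq_square power3_eq_cube)
    then show False
      using irreducible_no_root[OF irr, of "t - a"] ta by (simp add: degree_cheb)
  qed
  define z where "z = x ^ q"
  have z: "z ^ 3 - 3 * z = to_ac a"
    unfolding z_def by (rule frob_cheb_root[OF x])
  have "z \<noteq> x"
    using norat[OF x] by (simp add: z_def)
  have "(x - z) * (x ^ 2 + x * z + z ^ 2 - 3) = (x ^ 3 - 3 * x) - (z ^ 3 - 3 * z)"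
    by (simp add: algebra_simps power2_eq_square power3_eq_cube)
  then have e: "x ^ 2 + x * z + z ^ 2 - 3 = 0"
    using x z \<open>z \<noteq> x\<close> by simp
  have "(- x - z) ^ 3 - 3 * (- x - z) =
      (x ^ 3 - 3 * x) - (2 * x + z) * (x ^ 2 + x * z + z ^ 2 - 3)"
    by (simp add: algebra_simps power2_eq_square power3_eq_cube)
  then have "(- x - z) ^ 3 - 3 * (- x - z) = to_ac a"
    using e x by simp
  moreover have "(- x - z) ^ q = - x - z"
  proof -
    have "z ^ q = x"
      using x2 by (simp add: z_def power2_eq_square power_mult)
    then show ?thesis
      using frob_diff[of "- x" z 1] frob_minus[of x 1] by (simp add: z_def)
  qed
  ultimately show False
    using norat by blast
qed

text \<open>Frobenius acts on the three roots as a 3-cycle, an even permutation, so it fixes the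
  product of their differences, a square root of the discriminant.\<close>

lemma irreducible_cheb_discriminant:
  assumes irr: "Factorial_Ring.irreducible (cheb a)"
  obtains b where "b ^ 2 = -3 * (a ^ 2 - 4)"
proof -
  obtain y where y: "poly_ac (cheb a) y = 0"
    using poly_ac_root_exists[of "cheb a"] by (auto simp: degree_cheb)
  define x where "x = y + to_ac a"
  have x: "x ^ 3 - 3 * x = to_ac a"
    using y by (simp add: poly_ac_cheb x_def)
  define u v where "u = x ^ q" and "v = u ^ q"
  have u: "u ^ 3 - 3 * u = to_ac a" unfolding u_def by (rule frob_cheb_root[OF x])
  have v: "v ^ 3 - 3 * v = to_ac a" unfolding v_def by (rule frob_cheb_root[OF u])
  have v_eq: "v = x ^ (q ^ 2)"
    by (simp add: u_def v_def power2_eq_square power_mult)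
  have vx: "v \<noteq> x"
    using irreducible_cheb_no_quadratic_root[OF irr x] v_eq by simp
  have ux: "u \<noteq> x"
  proof
    assume "u = x"
    then have "v = x" by (simp add: v_def u_def)
    then show False using vx by simp
  qed
  have inj: "r = t" if "r ^ q = t ^ q" for r t :: "'q alg_closure"
    using frob_inj[of r 1 t] that by simp
  have vu: "v \<noteq> u"
    using ux inj[of u x] by (auto simp: v_def u_def)
  have quad: "r ^ 2 + r * t + t ^ 2 = 3"
    if "r ^ 3 - 3 * r = to_ac a" "t ^ 3 - 3 * t = to_ac a" "r \<noteq> t" for r t
  proof -
    have "(r - t) * (r ^ 2 + r * t + t ^ 2 - 3) = (r ^ 3 - 3 * r) - (t ^ 3 - 3 * t)"
      by (simp add: algebra_simps power2_eq_square power3_eq_cube)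
    then show ?thesis
      using that by simp
  qed
  \<comment> \<open>The shifted cubic has no quadratic term, so its roots sum to zero.\<close>
  have third: "r = - x - u" if r: "r ^ 3 - 3 * r = to_ac a" "r \<noteq> x" "r \<noteq> u" for r
  proof -
    have "(u - r) * (x + u + r) = (x ^ 2 + x * u + u ^ 2) - (x ^ 2 + x * r + r ^ 2)"
      by (simp add: algebra_simps power2_eq_square)
    also have "\<dots> = 0"
      using quad[OF x u] quad[OF x r(1)] ux r by auto
    finally have "x + u + r = 0"
      using r by simp
    then show ?thesis
      by (simp add: eq_neg_iff_add_eq_0 algebra_simps)
  qed
  have v3: "v = - x - u"
    using third[OF v] vx vu by simp
  \<comment> \<open>By injectivity of Frobenius, \<open>v ^ q\<close> is a root other than
    \<open>u\<close> and \<open>v\<close>; this closes the cycle at \<open>x\<close>.\<close>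
  have "v ^ q \<noteq> u" "v ^ q \<noteq> v"
    using inj[of v x] inj[of v u] vx vu by (auto simp: u_def v_def)
  then have vq: "v ^ q = x"
    using third[OF frob_cheb_root[OF v]] v3 by metis
  define D where "D = (x - u) * (u - v) * (v - x)"
  have "D ^ q = (u - v) * (v - x) * (x - u)"
    using frob_diff[of _ _ 1] by (simp add: D_def power_mult_distrib vq flip: u_def v_def)
  then have "D ^ q = D"
    by (simp add: D_def mult_ac)
  then obtain t where t: "D = to_ac t"
    unfolding frob_fixed_iff by blast
  have xu: "x ^ 2 + x * u + u ^ 2 = 3"
    using quad[OF x u] ux by simp
  have D3: "D = (x - u) * ((x + 2 * u) * (- 2 * x - u))"
    by (simp add: D_def v3 algebra_simps)
  \<comment> \<open>The discriminant formula for a depressed cubic; with the values 3 and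
    \<open>- to_ac a\<close> it becomes
    \<open>108 - 27 * a ^ 2 = 9 * (-3 * (a ^ 2 - 4))\<close>.\<close>
  have "D ^ 2 = 4 * (x ^ 2 + x * u + u ^ 2) ^ 3 - 27 * (x * u * (x + u)) ^ 2"
    unfolding D3 by (simp add: algebra_simps power2_eq_square power3_eq_cube)
  also have "x * u * (x + u) = - to_ac a"
  proof -
    have "x * u * (x + u) = x * (x ^ 2 + x * u + u ^ 2) - x ^ 3"
      by (simp add: algebra_simps power2_eq_square power3_eq_cube)
    also have "\<dots> = - (x ^ 3 - 3 * x)"
      using xu by simp
    finally show ?thesis
      using x by simp
  qed
  finally have "to_ac (t ^ 2) = to_ac (9 * (-3 * (a ^ 2 - 4)))"
    using xu t by (simp add: algebra_simps)
  then have "t ^ 2 = 9 * (-3 * (a ^ 2 - 4))"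
    by (simp only: to_ac_eq_iff)
  moreover have "(3 :: 'q) \<noteq> 0"
    using three_neq_0 by (metis to_ac_0 to_ac_numeral)
  then have "(9 :: 'q) \<noteq> 0"
    using mult_eq_0_iff[of "3 :: 'q" 3] by simp
  ultimately have "(t / 3) ^ 2 = -3 * (a ^ 2 - 4)"
    by (simp only: power_divide) (subst nonzero_divide_eq_eq, auto)
  then show ?thesis using that by blast
qed

text \<open>A cube root \<open>g\<close> of \<open>c\<close> in the extension gives the root
  \<open>g + 1 / g\<close> of the shifted cubic, fixed by the square of Frobenius whether
  \<open>d\<close> is 1 or 2.\<close>

lemma irreducible_cheb_not_cube:
  fixes w :: "'q alg_closure"
  assumes irr: "Factorial_Ring.irreducible (cheb a)" and w: "w ^ 2 = -3"
    and c: "c \<noteq> 0" "c + 1 / c = to_ac a"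
  shows "\<not> is_cube_in (adjoin w) c"
proof
  assume "is_cube_in (adjoin w) c"
  then obtain g where g: "g \<in> adjoin w" "c = g ^ 3"
    unfolding is_cube_in_def by blast
  obtain d where d: "d = 1 \<or> d = 2" "adjoin w = {y. y ^ (q ^ d) = y}"
    using adjoin_sqrt_minus_3[OF w] by blast
  have "g ^ (q ^ 2) = g"
    using g(1) d frob_fixed_iterate[of g 1 2] by auto
  then have "(g + 1 / g) ^ (q ^ 2) = g + 1 / g"
    by (simp add: frob_add power_divide)
  moreover have "(g + 1 / g) ^ 3 - 3 * (g + 1 / g) = to_ac a"
    using c g(2) reciprocal_sum_cubed[of g] by auto
  ultimately show False
    using irreducible_cheb_no_quadratic_root[OF irr] by blast
qed

end

section \<open>The equivalence, via the mutually inverse roots of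
  \<open>x\<^sup>2 - \<alpha> x + 1\<close>\<close>

theorem proposition25:
  fixes \<alpha> :: "'q :: {field, finite}" and p s :: nat
    and \<delta> \<omega> :: "'q alg_closure"
  assumes "Factorial_Ring.prime p" and "p > 3" and "s \<ge> 1" and "CARD('q) = p ^ s"
    and "\<alpha> \<noteq> 2" and "\<alpha> \<noteq> -2"
    and "\<delta> ^ 2 = to_ac (\<alpha> ^ 2 - 4)"
    and "\<omega> ^ 2 = -3"
  shows "dynamically_irreducible [: \<alpha> ^ 3 - 4 * \<alpha>, 3 * \<alpha> ^ 2 - 3, 3 * \<alpha>, 1 :] \<longleftrightarrow>
     (\<exists>b::'q. b \<noteq> 0 \<and> b ^ 2 = -3 * (\<alpha> ^ 2 - 4)) \<and>
     \<not> is_cube_in (adjoin \<omega>) ((to_ac \<alpha> + \<delta>) / 2) \<and>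
     \<not> is_cube_in (adjoin \<omega>) ((to_ac \<alpha> - \<delta>) / 2)"
proof -
  interpret finite_field_closure "TYPE('q)" p s "CARD('q)"
    by unfold_locales (fact assms refl)+
  define c c' where "c = (to_ac \<alpha> + \<delta>) / 2" and "c' = (to_ac \<alpha> - \<delta>) / 2"
  have d2: "\<delta> ^ 2 = to_ac \<alpha> ^ 2 - 4"
    using assms(7) by simp
  have prod: "c * c' = 1"
  proof -
    have "c * c' = (to_ac \<alpha> ^ 2 - \<delta> ^ 2) / (2 * 2)"
      by (simp add: c_def c'_def algebra_simps power2_eq_square)
    also have "\<dots> = 4 / (2 * 2)"
      using d2 by simp
    also have "(4 :: 'q alg_closure) = 2 * 2" by simp
    also have "2 * 2 / (2 * 2) = (1 :: 'q alg_closure)" by (rule divide_self) simp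
    finally show ?thesis .
  qed
  have sum: "c + c' = to_ac \<alpha>"
    by (simp add: c_def c'_def field_simps)
  have ne: "c \<noteq> 0" "c' \<noteq> 0"
    using prod by auto
  have inv: "1 / c = c'" "1 / c' = c"
    using prod ne by (simp_all add: divide_eq_eq mult.commute)
  have rec: "c + 1 / c = to_ac \<alpha>" "c' + 1 / c' = to_ac \<alpha>"
    using sum inv by (simp_all add: add.commute)
  have roots: "x = c \<or> x = c'" if "x \<noteq> 0" "x + 1 / x = to_ac \<alpha>" for x
  proof -
    have "(x - c) * (x - c') = x ^ 2 - (c + c') * x + c * c'"
      by (simp add: algebra_simps power2_eq_square)
    also have "\<dots> = x ^ 2 - (x + 1 / x) * x + 1"
      by (simp only: sum prod that(2))
    also have "\<dots> = 0"
      using that(1) by (simp add: algebra_simps power2_eq_square)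
    finally show ?thesis by simp
  qed
  have "dynamically_irreducible (cheb \<alpha>) \<longleftrightarrow>
     (\<exists>b::'q. b \<noteq> 0 \<and> b ^ 2 = -3 * (\<alpha> ^ 2 - 4)) \<and>
     \<not> is_cube_in (adjoin \<omega>) c \<and> \<not> is_cube_in (adjoin \<omega>) c'" (is "?L \<longleftrightarrow> ?R")
  proof
    assume ?L
    \<comment> \<open>Only the first iterate is needed in this direction.\<close>
    then have "Factorial_Ring.irreducible ((pcompose (cheb \<alpha>) ^^ 1) [:0, 1:])"
      unfolding dynamically_irreducible_def by blast
    then have irr: "Factorial_Ring.irreducible (cheb \<alpha>)"
      by (simp add: pcompose_idR)
    obtain b where b: "b ^ 2 = -3 * (\<alpha> ^ 2 - 4)"
      using irreducible_cheb_discriminant[OF irr] by blast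
    have "(3 :: 'q) \<noteq> 0"
      using three_neq_0 by (metis to_ac_0 to_ac_numeral)
    moreover have "\<alpha> ^ 2 - 4 = (\<alpha> - 2) * (\<alpha> + 2)"
      by (simp add: algebra_simps power2_eq_square)
    moreover have "(\<alpha> - 2) * (\<alpha> + 2) \<noteq> 0"
      using assms(5,6) by (simp add: add_eq_0_iff2)
    ultimately have "b \<noteq> 0"
      using b by auto
    then show ?R
      using b irreducible_cheb_not_cube[OF irr assms(8)] ne rec by blast
  next
    assume R: ?R
    then obtain b where b: "b ^ 2 = -3 * (\<alpha> ^ 2 - 4)"
      by blast
    obtain d where d: "d = 1 \<or> d = 2" "adjoin \<omega> = {y. y ^ (CARD('q) ^ d) = y}"
      using adjoin_sqrt_minus_3[OF assms(8)] by blast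
    have w0: "\<omega> \<noteq> 0" using assms(8) three_neq_0[symmetric] by auto
    have "\<omega> \<in> adjoin \<omega>"
      using to_ac_add_mult_in_adjoin[of 0 1 \<omega>] by simp
    then have wq: "\<omega> ^ (CARD('q) ^ d) = \<omega>"
      using d by simp
    \<comment> \<open>The square condition makes \<open>\<omega> * \<delta>\<close> equal to
      \<open>b\<close> or \<open>- b\<close>, hence rational; so \<open>\<delta>\<close>, and with
      it \<open>c\<close> and \<open>c'\<close>, lies in \<open>adjoin \<omega>\<close>.\<close>
    have "(\<omega> * \<delta>) ^ 2 = to_ac (-3 * (\<alpha> ^ 2 - 4))"
      using assms(8) d2 by (simp add: power_mult_distrib)
    then have "(\<omega> * \<delta>) ^ 2 = to_ac b ^ 2"
      by (simp only: b[symmetric] to_ac_power)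
    then have "\<omega> * \<delta> = to_ac b \<or> \<omega> * \<delta> = to_ac (- b)"
      by (simp add: power2_eq_iff)
    then obtain e where "\<omega> * \<delta> = to_ac e"
      by blast
    then have "\<delta> = to_ac e / \<omega>"
      using w0 by (simp add: field_simps)
    then have "\<delta> ^ (CARD('q) ^ d) = \<delta>"
      using wq by (simp add: power_divide)
    then have "c \<in> adjoin \<omega>" "c' \<in> adjoin \<omega>"
      using d by (simp_all add: c_def c'_def power_divide frob_add frob_diff)
    then have "x \<in> adjoin \<omega> \<and> \<not> is_cube_in (adjoin \<omega>) x"
      if "x \<noteq> 0" "x + 1 / x = to_ac \<alpha>" for x
      using roots[OF that] R by blast
    then have "Factorial_Ring.irreducible ((pcompose (cheb \<alpha>) ^^ n) [:0, 1:])" for n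
      by (rule cheb_iterate_irreducible[OF assms(8) d])
    then show ?L
      unfolding dynamically_irreducible_def by (simp add: degree_cheb)
  qed
  then show ?thesis
    unfolding cheb_def c_def c'_def .
qed

end
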